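(* For every integer $n\ge5$, the complexity of the system of linear forms $(\psi_1,\dots,\psi_{n^2})$ on $\mathbb{Z}^{n^2-2n}$ that defines $n\times n$ $\mathbb{Z}$-magic squares and is given by the elephant basis is $1$.
   Context: An $n\times n$ $\mathbb{Z}$-magic square is an $n\times n$ array of integers such that the sum of the entries in every row, every column and each of the two main diagonals is the same. Its entries are numbered $1,\dots,n^2$ from left to right and from top to bottom. Elephant basis: for $n\ge5$, the skeleton is the set of the following $n^2-2n$ positions of an $n\times n$ square: all positions of row $1$; all positions of rows $2,\dots,n-2$ except the last one of each row; all positions of row $n-1$ except the second, the $(n-2)$-th and the last. For any assignment of integers to the skeleton positions there is a unique $n\times n$ $\mathbb{Z}$-magic square with these entries on the skeleton. The elephant basis consists of the $n^2-2n$ $\mathbb{Z}$-magic squares having entry $1$ in one skeleton position and $0$ in all the other skeleton positions; order them as $v_1,\dots,v_{n^2-2n}$ according to the reading order of the skeleton positions. Linear forms: $\psi_i(x_1,\dots,x_{n^2-2n})$ is the $i$-th entry of $\sum_j x_jv_j$, i.e. the coefficient of $x_j$ in $\psi_i$ is the $i$-th entry of $v_j$. Complexity: let $\Psi=(\psi_1,\dots,\psi_t)$ be a system of linear forms. For an integer $s\ge0$, $\Psi$ has $i$-complexity at most $s$ if one can write the set of $t-1$ forms $\{\psi_1,\dots,\psi_{i-1},\psi_{i+1},\dots,\psi_t\}$ as a union of $s+1$ sets in such a way that $\psi_i$ does not lie in the linear span over $\mathbb{Q}$ of any of these sets (for affine-linear forms one uses the affine-linear span over $\mathbb{Q}$).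 The complexity of $\Psi$ is the least $s$ for which the system has $i$-complexity at most $s$ for all $1\le i\le t$, or $\infty$ if no such $s$ exists. *)

theory Defs
  imports "Jordan_Normal_Form.Matrix" "HOL-Library.Extended_Nat" "HOL-Library.Function_Algebras"
begin

section \<open>Complexity of a system of linear forms\<close>

text \<open>
  Integer-valued forms are compared inside the rational vector space of all functions
  \<open>'a \<Rightarrow> rat\<close>.
\<close>

global_interpretation rat_fun: vector_space "\<lambda>(c::rat) (f :: 'a \<Rightarrow> rat) x. c * f x"
  by unfold_locales (auto simp: algebra_simps fun_eq_iff)

definition rat_form :: "('a \<Rightarrow> int) \<Rightarrow> 'a \<Rightarrow> rat" where
  "rat_form f = (\<lambda>x. of_int (f x))"

text \<open>
  A system is a family \<open>\<Psi>\<close> with indices \<open>1, \<dots>, t\<close>. The other forms are those with a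
  different \<^emph>\<open>index\<close>: if \<open>\<Psi> k = \<Psi> i\<close> for some \<open>k \<noteq> i\<close>, then \<open>\<Psi> i\<close> itself is among the
  forms that have to be covered. The covering sets may overlap and may be empty.
\<close>

definition index_complexity_le ::
    "(nat \<Rightarrow> 'a \<Rightarrow> int) \<Rightarrow> nat \<Rightarrow> nat \<Rightarrow> nat \<Rightarrow> bool" where
  "index_complexity_le \<Psi> t i s \<longleftrightarrow>
     (\<exists>A :: nat \<Rightarrow> ('a \<Rightarrow> int) set.
        \<Psi> ` ({1..t} - {i}) = (\<Union>c\<in>{1..s + 1}. A c) \<and>
        (\<forall>c\<in>{1..s + 1}. rat_form (\<Psi> i) \<notin> rat_fun.span (rat_form ` A c)))"

text \<open>The infimum of the empty set of extended naturals is \<open>\<infinity>\<close>.\<close>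

definition complexity :: "(nat \<Rightarrow> 'a \<Rightarrow> int) \<Rightarrow> nat \<Rightarrow> enat" where
  "complexity \<Psi> t = Inf {enat s | s. \<forall>i\<in>{1..t}. index_complexity_le \<Psi> t i s}"


section \<open>Magic squares and the elephant basis\<close>

text \<open>
  Rows and columns of a matrix are indexed from 0, whereas the entry numbers, the skeleton and
  the basis are indexed from 1.
\<close>

definition magic_square :: "nat \<Rightarrow> int mat \<Rightarrow> bool" where
  "magic_square n M \<longleftrightarrow> M \<in> carrier_mat n n \<and>
     (\<exists>S. (\<forall>r<n. (\<Sum>c<n. M $$ (r, c)) = S) \<and>
          (\<forall>c<n. (\<Sum>r<n. M $$ (r, c)) = S) \<and>
          (\<Sum>r<n. M $$ (r, r)) = S \<and>
          (\<Sum>r<n. M $$ (r, n - 1 - r)) = S)"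

definition entry :: "nat \<Rightarrow> int mat \<Rightarrow> nat \<Rightarrow> int" where
  "entry n M k = M $$ ((k - 1) div n, (k - 1) mod n)"

definition skeleton_positions :: "nat \<Rightarrow> (nat \<times> nat) set" where
  "skeleton_positions n =
     {1} \<times> {1..n} \<union>
     {2..n - 2} \<times> ({1..n} - {n}) \<union>
     {n - 1} \<times> ({1..n} - {2, n - 2, n})"

definition skeleton :: "nat \<Rightarrow> nat set" where
  "skeleton n = (\<lambda>(r, c). (r - 1) * n + c) ` skeleton_positions n"

definition skeleton_nth :: "nat \<Rightarrow> nat \<Rightarrow> nat" where
  "skeleton_nth n j = sorted_list_of_set (skeleton n) ! (j - 1)"

definition elephant_basis :: "nat \<Rightarrow> nat \<Rightarrow> int mat" where
  "elephant_basis n j = (THE M. magic_square n M \<and>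
     (\<forall>k\<in>skeleton n. entry n M k = (if k = skeleton_nth n j then 1 else 0)))"

text \<open>
  Points of \<open>\<int>\<^sup>d\<close> with \<open>d = n\<^sup>2 - 2 * n\<close> are functions \<open>x\<close> of which only the values
  \<open>x 1, \<dots>, x d\<close> are used, so the form has the same rational linear relations as on \<open>\<int>\<^sup>d\<close>.
\<close>

definition elephant_form :: "nat \<Rightarrow> nat \<Rightarrow> (nat \<Rightarrow> int) \<Rightarrow> int" where
  "elephant_form n i x = (\<Sum>j = 1..n\<^sup>2 - 2 * n. x j * entry n (elephant_basis n j) i)"

end

theory Submission
  imports Defs
begin

text \<open>
  Complexity \<open>0\<close> is impossible because the entries of the first row and those of the second
  row have the same sum: the first form is a rational combination of others
  (\<open>first_entry_dependent\<close>).

  For complexity at most \<open>1\<close>, a form \<open>\<psi>\<^sub>i\<close> is certainly outside the span of a set of forms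
  if some point kills every form of the set but not \<open>\<psi>\<^sub>i\<close>. Evaluating the whole system at a point
  yields a magic square, and every magic square arises in this way, from the point whose coordinates
  are its skeleton entries (\<open>elephant_form_at_magic\<close>). Hence it suffices to find, for each cell,
  two magic squares that are nonzero at this cell and have no other cell in the intersection of
  their supports; one part of the required cover consists of the entries where the first square
  vanishes and the other of those where the second does (\<open>isolable_imp_index_complexity_le\<close>).

  Such pairs exist already on few rows and columns. Write \<open>i' = n - 1 - i\<close>, so that the
  diagonals consist of the cells \<open>(i, i)\<close> and \<open>(i, i')\<close>. A zero-sum \<open>5 \<times> 5\<close> square placed on the rows and columns
  \<open>x, y, z, y', x'\<close> of an \<open>n \<times> n\<close> square remains magic, whatever \<open>n\<close> is, provided that
  \<open>z = z'\<close> or that its central entry vanishes (\<open>magic_sum_spread\<close>). For \<open>n \<ge> 5\<close> there are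
  always enough indices for such a frame through a given cell, and up to the choice of the
  frame only six kinds of cells have to be treated (\<open>every_cell_isolable\<close>).

  The elephant basis itself rests on a triangularity argument. The cells outside the skeleton,
  called pivots, can be matched with lines and ordered such that each pivot is the last one on its
  line. The line sums therefore determine the pivots successively, with coefficient \<open>1\<close> at every
  step, so that no denominators appear (\<open>magic_extension_exists\<close>,
  \<open>magic_determined_by_skeleton\<close>).
\<close>


section \<open>Magic arrays\<close>

definition cells :: "nat \<Rightarrow> (nat \<times> nat) set" where
  "cells n = {..<n} \<times> {..<n}"

definition row_line :: "nat \<Rightarrow> nat \<Rightarrow> (nat \<times> nat) set" where
  "row_line n r = {r} \<times> {..<n}"

definition col_line :: "nat \<Rightarrow> nat \<Rightarrow> (nat \<times> nat) set" where
  "col_line n c = {..<n} \<times> {c}"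

definition main_diagonal :: "nat \<Rightarrow> (nat \<times> nat) set" where
  "main_diagonal n = (\<lambda>r. (r, r)) ` {..<n}"

definition anti_diagonal :: "nat \<Rightarrow> (nat \<times> nat) set" where
  "anti_diagonal n = (\<lambda>r. (r, n - 1 - r)) ` {..<n}"

definition magic_sum :: "nat \<Rightarrow> (nat \<times> nat \<Rightarrow> int) \<Rightarrow> int \<Rightarrow> bool" where
  "magic_sum n f S \<longleftrightarrow>
     (\<forall>r<n. sum f (row_line n r) = S) \<and> (\<forall>c<n. sum f (col_line n c) = S) \<and>
     sum f (main_diagonal n) = S \<and> sum f (anti_diagonal n) = S"

lemmas line_defs = row_line_def col_line_def main_diagonal_def anti_diagonal_def

lemma sum_row_line: "sum f (row_line n r) = (\<Sum>c<n. f (r, c))"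
proof -
  have "row_line n r = (\<lambda>c. (r, c)) ` {..<n}" by (auto simp: row_line_def)
  then show ?thesis by (simp add: sum.reindex inj_on_def)
qed

lemma sum_col_line: "sum f (col_line n c) = (\<Sum>r<n. f (r, c))"
proof -
  have "col_line n c = (\<lambda>r. (r, c)) ` {..<n}" by (auto simp: col_line_def)
  then show ?thesis by (simp add: sum.reindex inj_on_def)
qed

lemma sum_main_diagonal: "sum f (main_diagonal n) = (\<Sum>r<n. f (r, r))"
  by (simp add: main_diagonal_def sum.reindex inj_on_def)

lemma sum_anti_diagonal: "sum f (anti_diagonal n) = (\<Sum>r<n. f (r, n - 1 - r))"
  by (simp add: anti_diagonal_def sum.reindex inj_on_def)

lemmas sum_line = sum_row_line sum_col_line sum_main_diagonal sum_anti_diagonal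

lemma magic_square_iff:
  "magic_square n M \<longleftrightarrow> M \<in> carrier_mat n n \<and> (\<exists>S. magic_sum n (($$) M) S)"
  by (simp add: magic_square_def magic_sum_def sum_line)

lemma magic_square_mat: "magic_sum n f S \<Longrightarrow> magic_square n (mat n n f)"
  unfolding magic_square_iff by (intro conjI exI[of _ S]) (auto simp: magic_sum_def sum_line)

lemma magic_sum_diff:
  "magic_sum n f S \<Longrightarrow> magic_sum n g T \<Longrightarrow> magic_sum n (\<lambda>p. f p - g p) (S - T)"
  by (simp add: magic_sum_def sum_subtractf)

lemma magic_sum_combination:
  assumes "\<And>j. j \<in> J \<Longrightarrow> magic_sum n (f j) (S j)"
  shows "magic_sum n (\<lambda>p. \<Sum>j\<in>J. x j * f j p) (\<Sum>j\<in>J. x j * S j)"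
proof -
  have "(\<Sum>p\<in>L. \<Sum>j\<in>J. x j * f j p) = (\<Sum>j\<in>J. x j * sum (f j) L)" for L
    by (subst sum.swap) (simp add: sum_distrib_left)
  then show ?thesis
    using assms by (simp add: magic_sum_def)
qed


section \<open>Triangular systems of line sums\<close>

text \<open>
  Adding the points of \<open>P\<close> by increasing rank, each new point is free to correct the sum of its own
  line and does not disturb the lines settled before.
\<close>

lemma triangular_system_solvable:
  fixes L :: "'a \<Rightarrow> 'a set" and rk :: "'a \<Rightarrow> nat" and f :: "'a \<Rightarrow> 'b::ab_group_add"
  assumes "finite P"
    and "\<And>p. p \<in> P \<Longrightarrow> finite (L p) \<and> p \<in> L p"
    and "\<And>p q. p \<in> P \<Longrightarrow> q \<in> P \<Longrightarrow> q \<in> L p \<Longrightarrow> q \<noteq> p \<Longrightarrow> rk q < rk p"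
  shows "\<exists>g. (\<forall>q. q \<notin> P \<longrightarrow> g q = f q) \<and> (\<forall>p\<in>P. sum g (L p) = S)"
  using assms
proof (induction P rule: finite_ranking_induct[where f = rk])
  case empty
  then show ?case by auto
next
  case (insert x P)
  show ?case
  proof (cases "x \<in> P")
    case True
    then show ?thesis using insert by (simp add: insert_absorb)
  next
    case False
    have "\<exists>g. (\<forall>q. q \<notin> P \<longrightarrow> g q = f q) \<and> (\<forall>p\<in>P. sum g (L p) = S)"
      using insert.prems by (intro insert.IH) auto
    then obtain g where g: "\<forall>q. q \<notin> P \<longrightarrow> g q = f q" "\<forall>p\<in>P. sum g (L p) = S"
      by blast
    define h where "h = g(x := S - sum g (L x - {x}))"
    have "sum h (L p) = S" if "p \<in> P" for p
    proof -
      \<comment> \<open>\<open>x\<close> has maximal rank, so it lies on none of the lines treated before.\<close>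
      have "x \<notin> L p"
        using that False insert.hyps(2)[of p] insert.prems(2)[of p x] by (auto simp: not_less)
      then have "sum h (L p) = sum g (L p)"
        by (intro sum.cong) (auto simp: h_def)
      with g that show ?thesis by simp
    qed
    moreover have "sum h (L x) = S"
    proof -
      have "sum h (L x) = h x + sum h (L x - {x})"
        using insert.prems(1)[of x] by (intro sum.remove) auto
      moreover have "sum h (L x - {x}) = sum g (L x - {x})"
        by (intro sum.cong) (auto simp: h_def)
      ultimately show ?thesis by (simp add: h_def)
    qed
    ultimately show ?thesis
      using g by (intro exI[of _ h]) (auto simp: h_def)
  qed
qed

text \<open>
  By induction on the rank, all summands on the line of a point other than the value at this point
  are already known to vanish.
\<close>

lemma triangular_system_unique:
  fixes L :: "'a \<Rightarrow> 'a set" and rk :: "'a \<Rightarrow> nat" and g :: "'a \<Rightarrow> 'b::ab_group_add"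
  assumes L: "\<And>p. p \<in> P \<Longrightarrow> finite (L p) \<and> p \<in> L p"
    and tri: "\<And>p q. p \<in> P \<Longrightarrow> q \<in> P \<Longrightarrow> q \<in> L p \<Longrightarrow> q \<noteq> p \<Longrightarrow> rk q < rk p"
    and off: "\<And>p q. p \<in> P \<Longrightarrow> q \<in> L p \<Longrightarrow> q \<notin> P \<Longrightarrow> g q = 0"
    and zero: "\<And>p. p \<in> P \<Longrightarrow> sum g (L p) = 0"
    and "p \<in> P"
  shows "g p = 0"
  using \<open>p \<in> P\<close>
proof (induction "rk p" arbitrary: p rule: less_induct)
  case less
  have "g q = 0" if "q \<in> L p - {p}" for q
    using that less tri off by (cases "q \<in> P") auto
  then have "sum g (L p) = g p"
    using L[OF less.prems] by (simp add: sum.remove[of "L p" p])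
  with zero[OF less.prems] show ?case by simp
qed


section \<open>Magic squares with prescribed skeleton\<close>

text \<open>
  The pivots are the cells outside the skeleton, in coordinates that start from \<open>0\<close>. Lines are
  assigned to them so that the sums can be solved in this order: rows \<open>1, \<dots>, n - 3\<close>, most columns
  and the main diagonal at once; then the antidiagonal for the cell \<open>(n - 2, 1)\<close> and the last column
  for \<open>(n - 2, n - 1)\<close>; then column \<open>1\<close> and row \<open>n - 2\<close>; finally column \<open>n - 3\<close>. The rank
  records the stage.
\<close>

definition pivots :: "nat \<Rightarrow> (nat \<times> nat) set" where
  "pivots n = {1..n - 3} \<times> {n - 1} \<union> {n - 2} \<times> {1, n - 3, n - 1} \<union> {n - 1} \<times> {..<n}"

fun pivot_line :: "nat \<Rightarrow> nat \<times> nat \<Rightarrow> (nat \<times> nat) set" where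
  "pivot_line n (r, c) =
     (if r = n - 1 \<and> c = n - 1 then main_diagonal n
      else if r = n - 1 then col_line n c
      else if r = n - 2 \<and> c = 1 then anti_diagonal n
      else if r = n - 2 \<and> c = n - 1 then col_line n c
      else row_line n r)"

fun pivot_rank :: "nat \<Rightarrow> nat \<times> nat \<Rightarrow> nat" where
  "pivot_rank n (r, c) =
     (if r = n - 1 then (if c = 1 then 2 else if c = n - 3 then 3 else 0)
      else if r = n - 2 then (if c = n - 3 then 2 else 1)
      else 0)"

lemma finite_pivots [simp]: "finite (pivots n)"
  by (simp add: pivots_def)

lemma pivots_subset_cells: "n \<ge> 5 \<Longrightarrow> pivots n \<subseteq> cells n"
  by (auto simp: pivots_def cells_def)

lemma card_pivots:
  assumes "n \<ge> 5"
  shows "card (pivots n) = 2 * n"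
proof -
  have "card (pivots n) = card ({1..n - 3} \<times> {n - 1}) + card ({n - 2} \<times> {1, n - 3, n - 1})
      + card ({n - 1} \<times> {..<n})"
    unfolding pivots_def using assms by (subst card_Un_disjoint; (subst card_Un_disjoint)?) auto
  moreover obtain m where "n = m + 5" using assms by (metis add.commute le_Suc_ex)
  ultimately show ?thesis by (simp add: card_cartesian_product)
qed

lemma pivot_on_line:
  assumes "n \<ge> 5" "p \<in> pivots n"
  shows "finite (pivot_line n p) \<and> p \<in> pivot_line n p"
proof -
  obtain m where "n = m + 5" using assms(1) by (metis add.commute le_Suc_ex)
  with assms(2) show ?thesis by (cases p) (auto simp: pivots_def line_defs)
qed

lemma pivot_rank_less:
  assumes "n \<ge> 5" "p \<in> pivots n" "q \<in> pivots n" "q \<in> pivot_line n p" "q \<noteq> p"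
  shows "pivot_rank n q < pivot_rank n p"
proof -
  obtain m where n: "n = m + 5" using assms(1) by (metis add.commute le_Suc_ex)
  obtain r c where p: "p = (r, c)" by fastforce
  obtain r' c' where q: "q = (r', c')" by fastforce
  have q_pivot: "1 \<le> r' \<and> r' \<le> m + 2 \<and> c' = m + 4 \<or>
      r' = m + 3 \<and> (c' = 1 \<or> c' = m + 2 \<or> c' = m + 4) \<or> r' = m + 4"
    using assms(3) by (auto simp: n q pivots_def)
  consider "1 \<le> r" "r \<le> m + 2" "c = m + 4"
    | "r = m + 3" "c = 1" | "r = m + 3" "c = m + 2" | "r = m + 3" "c = m + 4"
    | "r = m + 4" "c = m + 4" | "r = m + 4" "c \<noteq> m + 4"
    using assms(2) by (cases "c = m + 4") (auto simp: n p pivots_def)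
  then show ?thesis
    by cases (use assms(4,5) q_pivot in \<open>auto simp: n p q line_defs\<close>)
qed

lemma pivot_line_subset_cells: "n \<ge> 5 \<Longrightarrow> p \<in> pivots n \<Longrightarrow> pivot_line n p \<subseteq> cells n"
  by (cases p) (auto simp: pivots_def line_defs cells_def)

text \<open>
  Rows \<open>0\<close> and \<open>n - 1\<close> are the only lines without a pivot assigned to them. The first row consists of
  skeleton cells, so it prescribes the magic sum, and the sum of the last row follows by counting all
  entries by rows and by columns.
\<close>

lemma magic_sum_iff_pivot_lines:
  assumes n: "n \<ge> 5"
  shows "magic_sum n f S \<longleftrightarrow>
    sum f (row_line n 0) = S \<and> (\<forall>p\<in>pivots n. sum f (pivot_line n p) = S)"
proof
  assume "magic_sum n f S"
  with n show "sum f (row_line n 0) = S \<and> (\<forall>p\<in>pivots n. sum f (pivot_line n p) = S)"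
    by (auto simp: magic_sum_def pivots_def)
next
  assume *: "sum f (row_line n 0) = S \<and> (\<forall>p\<in>pivots n. sum f (pivot_line n p) = S)"
  have row: "sum f (row_line n r) = S" if r: "r < n - 1" for r
  proof -
    consider "r = 0" | "1 \<le> r" "r \<le> n - 3" | "r = n - 2"
      using r n by linarith
    then show ?thesis
    proof cases
      case 1
      with * show ?thesis by simp
    next
      case 2
      then have "(r, n - 1) \<in> pivots n" "pivot_line n (r, n - 1) = row_line n r"
        using n by (auto simp: pivots_def)
      with * show ?thesis by metis
    next
      case 3
      then have "(r, n - 3) \<in> pivots n" "pivot_line n (r, n - 3) = row_line n r"
        using n by (auto simp: pivots_def)
      with * show ?thesis by metis
    qed
  qed
  have col: "sum f (col_line n c) = S" if "c < n" for c
  proof (cases "c = n - 1")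
    case True
    then have "(n - 2, c) \<in> pivots n" "pivot_line n (n - 2, c) = col_line n c"
      using n by (auto simp: pivots_def)
    with * show ?thesis by metis
  next
    case False
    then have "(n - 1, c) \<in> pivots n" "pivot_line n (n - 1, c) = col_line n c"
      using n that by (auto simp: pivots_def)
    with * show ?thesis by metis
  qed
  have "(n - 1, n - 1) \<in> pivots n" "pivot_line n (n - 1, n - 1) = main_diagonal n"
    using n by (auto simp: pivots_def)
  with * have diag: "sum f (main_diagonal n) = S" by metis
  have "(n - 2, 1) \<in> pivots n" "pivot_line n (n - 2, 1) = anti_diagonal n"
    using n by (auto simp: pivots_def)
  with * have anti: "sum f (anti_diagonal n) = S" by metis
  have last_row: "sum f (row_line n (n - 1)) = S"
  proof -
    obtain k where k: "n = Suc k" using n by (cases n) auto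
    have "(\<Sum>r<n. sum f (row_line n r)) = (\<Sum>c<n. sum f (col_line n c))"
      unfolding sum_line by (rule sum.swap)
    also have "\<dots> = int n * S" using col by simp
    finally have "(\<Sum>r<k. sum f (row_line n r)) + sum f (row_line n k) = int n * S"
      using k by simp
    moreover have "(\<Sum>r<k. sum f (row_line n r)) = int k * S"
      using row k by simp
    ultimately show ?thesis
      using k by (simp add: algebra_simps)
  qed
  have "sum f (row_line n r) = S" if "r < n" for r
    using row[of r] last_row that by (cases "r = n - 1") auto
  with col diag anti show "magic_sum n f S" by (simp add: magic_sum_def)
qed

lemma magic_extension_exists:
  assumes n: "n \<ge> 5"
  shows "\<exists>g S. magic_sum n g S \<and> (\<forall>p. p \<notin> pivots n \<longrightarrow> g p = f p)"
proof -
  define S where "S = sum f (row_line n 0)"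
  obtain g where g: "\<forall>p. p \<notin> pivots n \<longrightarrow> g p = f p"
      "\<forall>p\<in>pivots n. sum g (pivot_line n p) = S"
    using triangular_system_solvable[of "pivots n" "pivot_line n" "pivot_rank n" f S]
      pivot_on_line[OF n] pivot_rank_less[OF n] by auto
  have "sum g (row_line n 0) = S"
    unfolding S_def using n by (intro sum.cong refl) (auto simp: g pivots_def row_line_def)
  with g n show ?thesis by (auto simp: magic_sum_iff_pivot_lines)
qed

lemma magic_determined_by_skeleton:
  assumes n: "n \<ge> 5" and f: "magic_sum n f S" and g: "magic_sum n g T"
    and eq: "\<And>p. p \<in> cells n - pivots n \<Longrightarrow> f p = g p"
    and p: "p \<in> cells n"
  shows "f p = g p"
proof -
  let ?h = "\<lambda>p. f p - g p"
  have h: "magic_sum n ?h (S - T)"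
    by (rule magic_sum_diff[OF f g])
  have "sum ?h (row_line n 0) = 0"
    using n by (intro sum.neutral) (auto simp: eq cells_def pivots_def row_line_def)
  with h n have zero: "\<forall>q\<in>pivots n. sum ?h (pivot_line n q) = 0"
    by (simp add: magic_sum_iff_pivot_lines)
  have "?h p = 0" if "p \<in> pivots n"
  proof (rule triangular_system_unique[where P = "pivots n" and L = "pivot_line n" and rk = "pivot_rank n"])
    show "?h q = 0" if "p' \<in> pivots n" "q \<in> pivot_line n p'" "q \<notin> pivots n" for p' q
      using eq[of q] pivot_line_subset_cells[OF n that(1)] that by auto
  qed (use that zero pivot_on_line[OF n] pivot_rank_less[OF n] in auto)
  with eq p show ?thesis by (cases "p \<in> pivots n") auto
qed


section \<open>Evaluating the elephant forms\<close>

definition cell_of :: "nat \<Rightarrow> nat \<Rightarrow> nat \<times> nat" where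
  "cell_of n k = ((k - 1) div n, (k - 1) mod n)"

lemma entry_eq: "entry n M k = M $$ cell_of n k"
  by (simp add: entry_def cell_of_def)

lemma bij_betw_cell_of:
  assumes n: "n > 0"
  shows "bij_betw (cell_of n) {1..n\<^sup>2} (cells n)"
proof (rule bij_betwI[where g = "\<lambda>(r, c). r * n + c + 1"])
  show "cell_of n \<in> {1..n\<^sup>2} \<rightarrow> cells n"
    using n by (auto simp: cell_of_def cells_def power2_eq_square less_mult_imp_div_less)
  show "(\<lambda>(r, c). r * n + c + 1) \<in> cells n \<rightarrow> {1..n\<^sup>2}"
  proof
    fix p assume "p \<in> cells n"
    then obtain r c where p: "p = (r, c)" "r < n" "c < n" by (auto simp: cells_def)
    then have "(r + 1) * n \<le> n * n" by (intro mult_right_mono) auto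
    with p show "(case p of (r, c) \<Rightarrow> r * n + c + 1) \<in> {1..n\<^sup>2}"
      by (simp add: power2_eq_square)
  qed
qed (use n in \<open>auto simp: cell_of_def cells_def\<close>)

lemma skeleton_eq:
  assumes n: "n \<ge> 5"
  shows "skeleton n = {k\<in>{1..n\<^sup>2}. cell_of n k \<notin> pivots n}"
proof -
  let ?g = "\<lambda>(r, c). (r - 1) * n + c"
  have pos: "(r, c) \<in> skeleton_positions n \<longleftrightarrow>
      r \<ge> 1 \<and> c \<ge> 1 \<and> (r - 1, c - 1) \<in> cells n - pivots n" for r c
  proof -
    obtain m where m: "n = m + 5" using n by (metis add.commute le_Suc_ex)
    consider "r = 0 \<or> c = 0" | "r = 1" "c \<ge> 1" | "2 \<le> r" "r \<le> m + 3" "c \<ge> 1"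
      | "r = m + 4" "c \<ge> 1" | "r \<ge> m + 5" "c \<ge> 1"
      by linarith
    then show ?thesis
      by cases (auto simp: m skeleton_positions_def cells_def pivots_def)
  qed
  have cell: "cell_of n (?g (r, c)) = (r - 1, c - 1) \<and> ?g (r, c) \<in> {1..n\<^sup>2}"
    if "(r, c) \<in> skeleton_positions n" for r c
  proof -
    from that have rc: "r \<ge> 1" "c \<ge> 1" "r - 1 < n" "c - 1 < n"
      unfolding pos by (auto simp: cells_def)
    obtain r' c' where "r = Suc r'" "c = Suc c'" using rc by (metis One_nat_def Suc_le_D)
    then have cell: "cell_of n (?g (r, c)) = (r - 1, c - 1)" using rc by (simp add: cell_of_def)
    have "(r - 1) * n + c \<le> r * n" using rc by (cases r) auto
    also have "\<dots> \<le> n * n" using rc by (intro mult_right_mono) auto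
    finally have "?g (r, c) \<le> n\<^sup>2" by (simp add: power2_eq_square)
    with cell rc show ?thesis by simp
  qed
  show ?thesis
  proof (intro equalityI subsetI)
    fix k assume "k \<in> skeleton n"
    then obtain r c where "k = ?g (r, c)" "(r, c) \<in> skeleton_positions n"
      by (auto simp: skeleton_def)
    with cell[of r c] pos[of r c] show "k \<in> {k\<in>{1..n\<^sup>2}. cell_of n k \<notin> pivots n}" by auto
  next
    fix k assume k: "k \<in> {k\<in>{1..n\<^sup>2}. cell_of n k \<notin> pivots n}"
    let ?r = "(k - 1) div n + 1" and ?c = "(k - 1) mod n + 1"
    from k have "cell_of n k \<in> cells n"
      using bij_betw_cell_of[of n] n by (auto simp: bij_betw_def)
    with k have "(?r, ?c) \<in> skeleton_positions n"
      unfolding pos by (simp add: cell_of_def)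
    moreover have "?g (?r, ?c) = k"
      using k by (simp add: add.assoc[symmetric])
    ultimately show "k \<in> skeleton n"
      unfolding skeleton_def by (metis image_eqI)
  qed
qed

text \<open>
  The enumeration of the skeleton matches the number of variables of the forms because there are
  exactly \<open>2 * n\<close> pivots.
\<close>

lemma skeleton_nth_bij:
  assumes n: "n \<ge> 5"
  shows "bij_betw (skeleton_nth n) {1..n\<^sup>2 - 2 * n} (skeleton n)"
proof -
  have "bij_betw (cell_of n) (skeleton n) (cells n - pivots n)"
  proof (rule bij_betw_subset[OF bij_betw_cell_of])
    have "cells n = cell_of n ` {1..n\<^sup>2}"
      using bij_betw_cell_of[of n] n by (auto simp: bij_betw_def)
    then show "cell_of n ` skeleton n = cells n - pivots n"
      by (auto simp: skeleton_eq[OF n])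
  qed (use n in \<open>auto simp: skeleton_eq\<close>)
  then have "card (skeleton n) = card (cells n - pivots n)"
    by (rule bij_betw_same_card)
  also have "\<dots> = n\<^sup>2 - 2 * n"
    using n pivots_subset_cells[OF n] card_pivots[OF n]
    by (subst card_Diff_subset) (auto simp: cells_def power2_eq_square)
  finally have card: "card (skeleton n) = n\<^sup>2 - 2 * n" .
  have fin: "finite (skeleton n)" by (simp add: skeleton_eq[OF n])
  have "bij_betw ((!) (sorted_list_of_set (skeleton n))) {..<n\<^sup>2 - 2 * n} (skeleton n)"
    using fin card by (intro bij_betw_nth) auto
  moreover have "bij_betw (\<lambda>j. j - 1) {1..n\<^sup>2 - 2 * n} {..<n\<^sup>2 - 2 * n}"
    by (rule bij_betwI[where g = Suc]) auto
  ultimately show ?thesis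
    unfolding skeleton_nth_def
    using bij_betw_trans[of "\<lambda>j. j - 1" _ _ "(!) (sorted_list_of_set (skeleton n))"]
    by (simp add: comp_def)
qed

lemma skeleton_cell:
  assumes "n \<ge> 5" "p \<in> cells n - pivots n"
  obtains j where "j \<in> {1..n\<^sup>2 - 2 * n}" "cell_of n (skeleton_nth n j) = p"
proof -
  obtain k where "k \<in> {1..n\<^sup>2}" "cell_of n k = p"
    using assms bij_betw_cell_of[of n] by (force simp: bij_betw_def)
  with assms have "k \<in> skeleton n" by (auto simp: skeleton_eq)
  with skeleton_nth_bij[OF assms(1)] obtain j where "j \<in> {1..n\<^sup>2 - 2 * n}" "skeleton_nth n j = k"
    by (force simp: bij_betw_def)
  with \<open>cell_of n k = p\<close> that show thesis by auto
qed

text \<open>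
  Existence and uniqueness of the extension from the skeleton make the definite description in the
  definition of the basis meaningful.
\<close>

lemma elephant_basis:
  assumes n: "n \<ge> 5"
  shows "magic_square n (elephant_basis n j) \<and>
    (\<forall>k\<in>skeleton n. entry n (elephant_basis n j) k = (if k = skeleton_nth n j then 1 else 0))"
  unfolding elephant_basis_def
proof (rule theI')
  have skel: "k \<in> skeleton n \<longleftrightarrow> k \<in> {1..n\<^sup>2} \<and> cell_of n k \<notin> pivots n" for k
    by (simp add: skeleton_eq[OF n])
  have bij: "bij_betw (cell_of n) {1..n\<^sup>2} (cells n)" using n by (intro bij_betw_cell_of) simp
  have inj: "cell_of n k = cell_of n l \<longleftrightarrow> k = l" if "k \<in> {1..n\<^sup>2}" "l \<in> {1..n\<^sup>2}" for k l
    using bij that by (meson bij_betw_def inj_onD)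
  have in_cells: "cell_of n k \<in> cells n" if "k \<in> {1..n\<^sup>2}" for k
    using bij that by (rule bij_betwE[rule_format])
  \<comment> \<open>An index \<open>j\<close> outside the range yields an unspecified number \<open>skeleton_nth n j\<close>, whose cell could
      coincide with a genuine one; the bound on the number excludes this.\<close>
  define e :: "nat \<times> nat \<Rightarrow> int" where
    "e p = (if skeleton_nth n j \<in> {1..n\<^sup>2} \<and> p = cell_of n (skeleton_nth n j) then 1 else 0)" for p
  obtain g S where g: "magic_sum n g S" "\<forall>p. p \<notin> pivots n \<longrightarrow> g p = e p"
    using magic_extension_exists[OF n, of e] by blast
  have "entry n (mat n n g) k = (if k = skeleton_nth n j then 1 else 0)" if k: "k \<in> skeleton n" for k
  proof -
    have k': "k \<in> {1..n\<^sup>2}" "cell_of n k \<notin> pivots n" using k skel by auto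
    then have "entry n (mat n n g) k = e (cell_of n k)"
      using in_cells[of k] g(2) by (auto simp: entry_eq cells_def)
    also have "\<dots> = (if k = skeleton_nth n j then 1 else 0)"
      using k' inj[of k "skeleton_nth n j"] by (auto simp: e_def)
    finally show ?thesis .
  qed
  then have ex: "magic_square n (mat n n g) \<and>
      (\<forall>k\<in>skeleton n. entry n (mat n n g) k = (if k = skeleton_nth n j then 1 else 0))"
    using magic_square_mat[OF g(1)] by blast
  show "\<exists>!M. magic_square n M \<and> (\<forall>k\<in>skeleton n. entry n M k = (if k = skeleton_nth n j then 1 else 0))"
  proof (rule ex1I, rule ex)
    fix M assume M: "magic_square n M \<and> (\<forall>k\<in>skeleton n. entry n M k = (if k = skeleton_nth n j then 1 else 0))"
    then obtain T where T: "M \<in> carrier_mat n n" "magic_sum n (($$) M) T"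
      by (auto simp: magic_square_iff)
    obtain T' where T': "magic_sum n (($$) (mat n n g)) T'"
      using ex by (auto simp: magic_square_iff)
    have "M $$ p = mat n n g $$ p" if "p \<in> cells n" for p
    proof (rule magic_determined_by_skeleton[OF n T(2) T' _ that])
      fix q assume q: "q \<in> cells n - pivots n"
      then have "q \<in> cell_of n ` {1..n\<^sup>2}"
        using bij by (simp add: bij_betw_def)
      then obtain k where k: "k \<in> skeleton n" "q = cell_of n k"
        using q skel by blast
      then show "M $$ q = mat n n g $$ q"
        using M ex by (simp add: entry_eq)
    qed
    then show "M = mat n n g"
      using T(1) by (intro eq_matI) (auto simp: cells_def)
  qed
qed

lemma elephant_form_magic:
  assumes n: "n \<ge> 5"
  obtains S where "magic_sum n (\<lambda>p. \<Sum>j = 1..n\<^sup>2 - 2 * n. x j * elephant_basis n j $$ p) S"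
proof -
  have "\<exists>S. magic_sum n (($$) (elephant_basis n j)) S" for j
    using elephant_basis[OF n] by (auto simp: magic_square_iff)
  then obtain T where "\<And>j. magic_sum n (($$) (elephant_basis n j)) (T j)" by metis
  then have "magic_sum n (\<lambda>p. \<Sum>j = 1..n\<^sup>2 - 2 * n. x j * elephant_basis n j $$ p)
      (\<Sum>j = 1..n\<^sup>2 - 2 * n. x j * T j)"
    by (rule magic_sum_combination)
  then show thesis by (rule that)
qed

lemma elephant_form_eq:
  "elephant_form n i x = (\<Sum>j = 1..n\<^sup>2 - 2 * n. x j * elephant_basis n j $$ cell_of n i)"
  by (simp add: elephant_form_def entry_eq)

text \<open>
  At a point \<open>x\<close> the forms list the entries of a magic square with skeleton entries \<open>x\<close>. If
  \<open>x\<close> is read off from the skeleton of \<open>f\<close>, this square has to be \<open>f\<close>.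
\<close>

lemma elephant_form_at_magic:
  assumes n: "n \<ge> 5" and f: "magic_sum n f S" and i: "i \<in> {1..n\<^sup>2}"
  shows "elephant_form n i (\<lambda>j. f (cell_of n (skeleton_nth n j))) = f (cell_of n i)"
proof -
  let ?x = "\<lambda>j. f (cell_of n (skeleton_nth n j))"
  let ?g = "\<lambda>p. \<Sum>j = 1..n\<^sup>2 - 2 * n. ?x j * elephant_basis n j $$ p"
  obtain T where T: "magic_sum n ?g T"
    using elephant_form_magic[OF n] .
  have "?g p = f p" if "p \<in> cells n" for p
  proof (rule magic_determined_by_skeleton[OF n T f _ that])
    fix p assume p: "p \<in> cells n - pivots n"
    from skeleton_cell[OF n p]
    obtain i where i: "i \<in> {1..n\<^sup>2 - 2 * n}" "cell_of n (skeleton_nth n i) = p" .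
    have inj: "skeleton_nth n i = skeleton_nth n j \<longleftrightarrow> i = j" if "j \<in> {1..n\<^sup>2 - 2 * n}" for j
      using skeleton_nth_bij[OF n] i that by (auto simp: bij_betw_def dest: inj_onD)
    have "skeleton_nth n i \<in> skeleton n"
      using skeleton_nth_bij[OF n] i by (auto simp: bij_betw_def)
    then have "elephant_basis n j $$ p = (if i = j then 1 else 0)" if "j \<in> {1..n\<^sup>2 - 2 * n}" for j
      using elephant_basis[OF n, of j] inj[OF that] i by (auto simp: entry_eq)
    then have "?g p = (\<Sum>j = 1..n\<^sup>2 - 2 * n. if i = j then ?x j else 0)"
      by (intro sum.cong) auto
    also have "\<dots> = f p" using i by simp
    finally show "?g p = f p" .
  qed
  moreover have "cell_of n i \<in> cells n"
    using i bij_betw_cell_of[of n] n by (auto simp: bij_betw_def)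
  ultimately show ?thesis by (simp add: elephant_form_eq)
qed

section \<open>Complexity from points where a form survives\<close>

text \<open>
  Evaluation at \<open>x\<close> is a linear functional, so its kernel contains the span.
\<close>

lemma rat_form_notin_span:
  assumes "\<And>g. g \<in> A \<Longrightarrow> g x = 0" "f x \<noteq> 0"
  shows "rat_form f \<notin> rat_fun.span (rat_form ` A)"
proof
  have "rat_fun.subspace {h. h x = 0}"
    by (auto simp: rat_fun.subspace_def)
  then have "rat_fun.span (rat_form ` A) \<subseteq> {h. h x = 0}"
    using assms(1) by (intro rat_fun.span_minimal) (auto simp: rat_form_def)
  moreover assume "rat_form f \<in> rat_fun.span (rat_form ` A)"
  ultimately show False
    using assms(2) by (auto simp: rat_form_def)
qed

lemma index_complexity_le_oneI:
  assumes "\<Psi> i x \<noteq> 0" "\<Psi> i y \<noteq> 0"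
    and "\<And>k. k \<in> {1..t} - {i} \<Longrightarrow> \<Psi> k x = 0 \<or> \<Psi> k y = 0"
  shows "index_complexity_le \<Psi> t i 1"
proof -
  define A where "A c = \<Psi> ` {k \<in> {1..t} - {i}. \<Psi> k (if c = (1::nat) then x else y) = 0}" for c
  have colours: "{1..1 + 1} = {1, 2 :: nat}" by auto
  have cover: "\<Psi> ` ({1..t} - {i}) = A 1 \<union> A 2"
  proof -
    have "\<forall>k\<in>{1..t} - {i}. \<Psi> k x = 0 \<or> \<Psi> k y = 0"
      using assms(3) by blast
    then show ?thesis
      unfolding A_def image_Un[symmetric] by (intro arg_cong[where f = "image \<Psi>"]) auto
  qed
  have "rat_form (\<Psi> i) \<notin> rat_fun.span (rat_form ` A 1)"
    using assms(1) by (intro rat_form_notin_span[where x = x]) (auto simp: A_def)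
  moreover have "rat_form (\<Psi> i) \<notin> rat_fun.span (rat_form ` A 2)"
    using assms(2) by (intro rat_form_notin_span[where x = y]) (auto simp: A_def)
  ultimately show ?thesis
    unfolding index_complexity_le_def colours using cover by (intro exI[of _ A]) simp
qed

lemma complexity_eq_oneI:
  assumes "\<And>i. i \<in> {1..t} \<Longrightarrow> index_complexity_le \<Psi> t i 1"
    and "i0 \<in> {1..t}" "\<not> index_complexity_le \<Psi> t i0 0"
  shows "complexity \<Psi> t = 1"
  unfolding complexity_def
proof (rule antisym)
  have "enat 1 \<in> {enat s | s. \<forall>i\<in>{1..t}. index_complexity_le \<Psi> t i s}"
    using assms(1) by blast
  then show "Inf {enat s | s. \<forall>i\<in>{1..t}. index_complexity_le \<Psi> t i s} \<le> 1"
    unfolding one_enat_def by (rule Inf_lower)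
  show "1 \<le> Inf {enat s | s. \<forall>i\<in>{1..t}. index_complexity_le \<Psi> t i s}"
  proof (rule Inf_greatest)
    fix e assume "e \<in> {enat s | s. \<forall>i\<in>{1..t}. index_complexity_le \<Psi> t i s}"
    then obtain s where s: "e = enat s" "index_complexity_le \<Psi> t i0 s"
      using assms(2) by blast
    with assms(3) have "s \<noteq> 0" by metis
    then have "1 \<le> s" by linarith
    then show "1 \<le> e"
      unfolding s(1) one_enat_def by (simp only: enat_ord_simps)
  qed
qed


section \<open>A linear relation between the forms\<close>

lemma sum_fun_apply: "(\<Sum>i\<in>I. f i) x = (\<Sum>i\<in>I. f i x)" for f :: "'i \<Rightarrow> 'a \<Rightarrow> 'b::comm_monoid_add"
  by (induction I rule: infinite_finite_induct) auto

text \<open>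
  The first two rows have equal sums; this is a relation in which the first form has coefficient
  \<open>1\<close> and all the other forms have index at least \<open>2\<close>.
\<close>

lemma first_entry_dependent:
  assumes n: "n \<ge> 5"
  shows "\<not> index_complexity_le (elephant_form n) (n\<^sup>2) 1 0"
proof
  assume "index_complexity_le (elephant_form n) (n\<^sup>2) 1 0"
  then obtain A :: "nat \<Rightarrow> ((nat \<Rightarrow> int) \<Rightarrow> int) set" where A: "elephant_form n ` ({1..n\<^sup>2} - {1}) = A 1"
      "rat_form (elephant_form n 1) \<notin> rat_fun.span (rat_form ` A 1)"
    unfolding index_complexity_le_def by auto
  let ?\<psi> = "\<lambda>k. rat_form (elephant_form n k)"
  let ?V = "rat_fun.span (rat_form ` A 1)"
  have V: "?\<psi> k \<in> ?V" if "k \<in> {2..n\<^sup>2}" for k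
    using that A(1)[symmetric] by (intro rat_fun.span_base) auto
  have row0: "cell_of n (c + 1) = (0, c)" if "c < n" for c
    using that by (simp add: cell_of_def)
  have row1: "cell_of n (n + c + 1) = (1, c)" if "c < n" for c
    using that by (simp add: cell_of_def)
  have rows: "(\<Sum>c<n. elephant_form n (c + 1) x) = (\<Sum>c<n. elephant_form n (n + c + 1) x)" for x
  proof -
    obtain S where "magic_sum n (\<lambda>p. \<Sum>j = 1..n\<^sup>2 - 2 * n. x j * elephant_basis n j $$ p) S"
      using elephant_form_magic[OF n] .
    with n show ?thesis
      by (simp add: magic_sum_def sum_line elephant_form_eq row0[simplified] row1[simplified])
  qed
  have "2 * n \<le> n\<^sup>2" using n by (simp add: power2_eq_square)
  have "?\<psi> 1 = (\<lambda>x. (\<Sum>c<n. ?\<psi> (n + c + 1)) x - (\<Sum>c\<in>{1..<n}. ?\<psi> (c + 1)) x)"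
  proof
    fix x
    have "(\<Sum>c<n. elephant_form n (c + 1) x) =
        elephant_form n 1 x + (\<Sum>c\<in>{1..<n}. elephant_form n (c + 1) x)"
      using n by (simp add: lessThan_atLeast0 sum.atLeast_Suc_lessThan)
    with rows[of x] have "of_int (elephant_form n 1 x) =
        (of_int ((\<Sum>c<n. elephant_form n (n + c + 1) x) - (\<Sum>c\<in>{1..<n}. elephant_form n (c + 1) x)) :: rat)"
      by simp
    then show "?\<psi> 1 x = (\<Sum>c<n. ?\<psi> (n + c + 1)) x - (\<Sum>c\<in>{1..<n}. ?\<psi> (c + 1)) x"
      by (simp add: rat_form_def sum_fun_apply)
  qed
  also have "\<dots> = (\<Sum>c<n. ?\<psi> (n + c + 1)) - (\<Sum>c\<in>{1..<n}. ?\<psi> (c + 1))"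
    by auto
  also have "\<dots> \<in> ?V"
    using \<open>2 * n \<le> n\<^sup>2\<close> by (intro rat_fun.span_diff rat_fun.span_sum V) auto
  finally show False using A(2) by contradiction
qed


section \<open>Isolating a cell by two magic arrays\<close>

definition isolable :: "nat \<Rightarrow> nat \<times> nat \<Rightarrow> bool" where
  "isolable n p \<longleftrightarrow> (\<exists>f g S T. magic_sum n f S \<and> magic_sum n g T \<and> f p \<noteq> 0 \<and> g p \<noteq> 0 \<and>
     (\<forall>q. q \<noteq> p \<longrightarrow> f q = 0 \<or> g q = 0))"

lemma isolable_imp_index_complexity_le:
  assumes n: "n \<ge> 5" and i: "i \<in> {1..n\<^sup>2}" and iso: "isolable n (cell_of n i)"
  shows "index_complexity_le (elephant_form n) (n\<^sup>2) i 1"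
proof -
  obtain f g S T where fg: "magic_sum n f S" "magic_sum n g T"
      "f (cell_of n i) \<noteq> 0" "g (cell_of n i) \<noteq> 0"
      "\<And>q. q \<noteq> cell_of n i \<Longrightarrow> f q = 0 \<or> g q = 0"
    using iso unfolding isolable_def by blast
  have "cell_of n k \<noteq> cell_of n i" if "k \<in> {1..n\<^sup>2} - {i}" for k
  proof -
    have "inj_on (cell_of n) {1..n\<^sup>2}"
      using bij_betw_cell_of[of n] n by (simp add: bij_betw_def)
    with that i show ?thesis by (auto dest: inj_onD)
  qed
  then have disj: "f (cell_of n k) = 0 \<or> g (cell_of n k) = 0" if "k \<in> {1..n\<^sup>2} - {i}" for k
    using fg(5) that by blast
  note val = elephant_form_at_magic[OF n fg(1)] elephant_form_at_magic[OF n fg(2)]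
  show ?thesis
  proof (rule index_complexity_le_oneI[where x = "\<lambda>j. f (cell_of n (skeleton_nth n j))"
        and y = "\<lambda>j. g (cell_of n (skeleton_nth n j))"])
    show "elephant_form n i (\<lambda>j. f (cell_of n (skeleton_nth n j))) \<noteq> 0"
      "elephant_form n i (\<lambda>j. g (cell_of n (skeleton_nth n j))) \<noteq> 0"
      using fg(3,4) by (simp_all only: val[OF i] not_False_eq_True)
    show "elephant_form n k (\<lambda>j. f (cell_of n (skeleton_nth n j))) = 0 \<or>
        elephant_form n k (\<lambda>j. g (cell_of n (skeleton_nth n j))) = 0"
      if "k \<in> {1..n\<^sup>2} - {i}" for k
      using disj[OF that] that by (simp only: val[of k] Diff_iff)
  qed
qed

definition zero_sum_pattern :: "(nat \<Rightarrow> nat \<Rightarrow> int) \<Rightarrow> bool" where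
  "zero_sum_pattern Q \<longleftrightarrow>
     (\<forall>a<5. (\<Sum>b<5. Q a b) = 0) \<and> (\<forall>b<5. (\<Sum>a<5. Q a b) = 0) \<and>
     (\<Sum>a<5. Q a a) = 0 \<and> (\<Sum>a<5. Q a (4 - a)) = 0"

text \<open>
  The array with entry \<open>Q a b\<close> in row \<open>\<sigma> a\<close> and column \<open>\<sigma> b\<close>, and zeros elsewhere.
\<close>

definition spread :: "(nat \<Rightarrow> nat) \<Rightarrow> (nat \<Rightarrow> nat \<Rightarrow> int) \<Rightarrow> nat \<times> nat \<Rightarrow> int" where
  "spread \<sigma> Q p = (if p \<in> \<sigma> ` {..<5} \<times> \<sigma> ` {..<5}
     then Q (the_inv_into {..<5} \<sigma> (fst p)) (the_inv_into {..<5} \<sigma> (snd p)) else 0)"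

text \<open>
  If \<open>\<sigma>\<close> commutes with reversal, lines go to lines. At the central index \<open>2\<close> this can be relaxed:
  if \<open>\<sigma> 2\<close> is not fixed by reversal, the antidiagonal passes through the row \<open>\<sigma> 2\<close> at a column
  outside the frame, hence misses the central entry of the pattern, and nothing is lost if this entry
  is zero. This makes patterns of odd size usable for even \<open>n\<close>.
\<close>

lemma magic_sum_spread:
  assumes \<sigma>: "inj_on \<sigma> {..<5}" "\<sigma> ` {..<5} \<subseteq> {..<n}"
    and rev: "\<And>a. a < 5 \<Longrightarrow> a \<noteq> 2 \<Longrightarrow> \<sigma> (4 - a) = n - 1 - \<sigma> a"
    and centre: "\<sigma> 2 = n - 1 - \<sigma> 2 \<or> Q 2 2 = 0"
    and Q: "zero_sum_pattern Q"
  shows "magic_sum n (spread \<sigma> Q) 0"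
proof -
  have inv: "the_inv_into {..<5} \<sigma> (\<sigma> a) = a" if "a < 5" for a
    using \<sigma>(1) that by (simp add: the_inv_into_f_f)
  have spread: "spread \<sigma> Q (\<sigma> a, \<sigma> b) = Q a b" if "a < 5" "b < 5" for a b
    using that by (simp add: spread_def inv)
  have restrict: "(\<Sum>r<n. h r) = (\<Sum>a<5. h (\<sigma> a))"
    if "\<And>r. r \<notin> \<sigma> ` {..<5} \<Longrightarrow> h r = 0" for h :: "nat \<Rightarrow> int"
  proof -
    have "(\<Sum>r<n. h r) = (\<Sum>r\<in>\<sigma> ` {..<5}. h r)"
      using \<sigma>(2) that by (intro sum.mono_neutral_right) auto
    also have "\<dots> = (\<Sum>a<5. h (\<sigma> a))" by (simp add: sum.reindex[OF \<sigma>(1)])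
    finally show ?thesis .
  qed
  have row: "(\<Sum>c<n. spread \<sigma> Q (r, c)) = 0" for r
  proof (cases "r \<in> \<sigma> ` {..<5}")
    case True
    then obtain a where "a < 5" "r = \<sigma> a" by auto
    with Q show ?thesis
      by (subst restrict) (auto simp: spread zero_sum_pattern_def, simp add: spread_def)
  qed (simp add: spread_def)
  have col: "(\<Sum>r<n. spread \<sigma> Q (r, c)) = 0" for c
  proof (cases "c \<in> \<sigma> ` {..<5}")
    case True
    then obtain b where "b < 5" "c = \<sigma> b" by auto
    with Q show ?thesis
      by (subst restrict) (auto simp: spread zero_sum_pattern_def, simp add: spread_def)
  qed (simp add: spread_def)
  have diag: "(\<Sum>r<n. spread \<sigma> Q (r, r)) = 0"
    using Q by (subst restrict) (auto simp: spread zero_sum_pattern_def, simp add: spread_def)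
  have "spread \<sigma> Q (\<sigma> a, n - 1 - \<sigma> a) = Q a (4 - a)" if a: "a < 5" for a
  proof (cases "a = 2 \<and> \<sigma> 2 \<noteq> n - 1 - \<sigma> 2")
    case True
    \<comment> \<open>The reversal of \<open>\<sigma> 2\<close> is not in the frame, since the frame without \<open>\<sigma> 2\<close> is closed under
        reversal.\<close>
    have "n - 1 - \<sigma> 2 \<noteq> \<sigma> b" if b: "b < 5" for b
    proof
      assume eq: "n - 1 - \<sigma> 2 = \<sigma> b"
      then have "b \<noteq> 2" using True by metis
      have "\<sigma> 2 < n" using \<sigma>(2) by (simp add: image_subset_iff)
      with rev[OF b \<open>b \<noteq> 2\<close>] eq have "\<sigma> (4 - b) = \<sigma> 2" by linarith
      then have "4 - b = 2" using \<sigma>(1) b by (auto dest: inj_onD)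
      with \<open>b \<noteq> 2\<close> show False by linarith
    qed
    then have "spread \<sigma> Q (\<sigma> a, n - 1 - \<sigma> a) = 0"
      using True by (auto simp: spread_def)
    with True centre show ?thesis by auto
  next
    case False
    then have "n - 1 - \<sigma> a = \<sigma> (4 - a)"
      using rev[OF a] by (cases "a = 2") auto
    then show ?thesis using a by (simp add: spread)
  qed
  then have anti: "(\<Sum>r<n. spread \<sigma> Q (r, n - 1 - r)) = 0"
    using Q by (subst restrict) (auto simp: zero_sum_pattern_def, simp add: spread_def)
  show ?thesis
    using row col diag anti by (simp add: magic_sum_def sum_line)
qed

definition pattern :: "int list list \<Rightarrow> nat \<Rightarrow> nat \<Rightarrow> int" where
  "pattern M a b = M ! a ! b"

definition isolating_patterns :: "int list list \<Rightarrow> int list list \<Rightarrow> nat \<Rightarrow> nat \<Rightarrow> bool" where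
  "isolating_patterns M N a b \<longleftrightarrow>
     zero_sum_pattern (pattern M) \<and> zero_sum_pattern (pattern N) \<and>
     pattern M a b \<noteq> 0 \<and> pattern N a b \<noteq> 0 \<and>
     (\<forall>a'<5. \<forall>b'<5. (a', b') \<noteq> (a, b) \<longrightarrow> pattern M a' b' = 0 \<or> pattern N a' b' = 0)"

lemma isolable_frame:
  assumes "x < n" "y < n" "z < n"
    and "x \<noteq> n - 1 - x" "y \<noteq> n - 1 - y" "y \<notin> {x, n - 1 - x}"
    and "z \<notin> {x, n - 1 - x, y, n - 1 - y}"
    and MN: "isolating_patterns M N a b" "a < 5" "b < 5"
    and centre: "z = n - 1 - z \<or> pattern M 2 2 = 0 \<and> pattern N 2 2 = 0"
  shows "isolable n ([x, y, z, n - 1 - y, n - 1 - x] ! a, [x, y, z, n - 1 - y, n - 1 - x] ! b)"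
proof -
  define xs where "xs = [x, y, z, n - 1 - y, n - 1 - x]"
  let ?\<sigma> = "\<lambda>i. xs ! i"
  have "n - 1 - y \<noteq> n - 1 - x" "x \<noteq> n - 1 - y"
    using assms(1,2,6) by auto
  with assms(4-7) have "distinct xs"
    unfolding xs_def by (simp only: distinct.simps list.set insert_iff empty_iff) blast
  then have inj: "inj_on ?\<sigma> {..<5}"
    by (intro inj_on_nth) (auto simp: xs_def)
  have "set xs \<subseteq> {..<n}" "length xs = 5" using assms(1-3) by (auto simp: xs_def)
  then have sub: "?\<sigma> ` {..<5} \<subseteq> {..<n}"
    using nth_mem[of _ xs] by fastforce
  have rev: "?\<sigma> (4 - i) = n - 1 - ?\<sigma> i" if "i < 5" "i \<noteq> 2" for i
  proof -
    from that have "i \<in> {0, 1, 3, 4}" by auto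
    with assms(1,2) show ?thesis by (auto simp: xs_def)
  qed
  have "?\<sigma> 2 = z" by (simp add: xs_def)
  then have magic: "magic_sum n (spread ?\<sigma> (pattern M)) 0" "magic_sum n (spread ?\<sigma> (pattern N)) 0"
    using MN centre by (auto intro!: magic_sum_spread inj sub rev simp: isolating_patterns_def)
  have val: "spread ?\<sigma> Q (?\<sigma> i, ?\<sigma> j) = Q i j" if "i < 5" "j < 5" for Q i j
    using that inj by (simp add: spread_def the_inv_into_f_f)
  have "spread ?\<sigma> (pattern M) q = 0 \<or> spread ?\<sigma> (pattern N) q = 0" if "q \<noteq> (?\<sigma> a, ?\<sigma> b)" for q
  proof (cases "q \<in> ?\<sigma> ` {..<5} \<times> ?\<sigma> ` {..<5}")
    case True
    then obtain i j where ij: "i < 5" "j < 5" "q = (?\<sigma> i, ?\<sigma> j)" by auto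
    with that have "(i, j) \<noteq> (a, b)" by auto
    with MN(1) ij show ?thesis by (simp add: val isolating_patterns_def)
  qed (simp add: spread_def)
  with magic MN show ?thesis
    unfolding isolable_def xs_def[symmetric]
    by (intro exI[of _ "spread ?\<sigma> (pattern M)"] exI[of _ "spread ?\<sigma> (pattern N)"] exI[of _ 0])
       (auto simp: val isolating_patterns_def)
qed

text \<open>
  In the patterns below, rows and columns are labelled \<open>x, y, z, y', x'\<close>. For the cell \<open>(x, y)\<close>
  the supports are the rectangles \<open>{x, x'} \<times> {y, z}\<close> and \<open>{x, z} \<times> {y, y'}\<close> with alternating
  signs. They miss both diagonals because no row of such a rectangle equals one of its columns or the
  reversal of one.
\<close>

lemma isolating_patterns_off_diagonal:
  "isolating_patterns
     [[ 0, 1,-1, 0, 0],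
      [ 0, 0, 0, 0, 0],
      [ 0, 0, 0, 0, 0],
      [ 0, 0, 0, 0, 0],
      [ 0,-1, 1, 0, 0]]
     [[ 0, 1, 0,-1, 0],
      [ 0, 0, 0, 0, 0],
      [ 0,-1, 0, 1, 0],
      [ 0, 0, 0, 0, 0],
      [ 0, 0, 0, 0, 0]] 0 1"
  by code_simp

text \<open>
  An alternating rectangle with a corner on a diagonal does not have diagonal sum zero: of its other corners only
  the opposite one can lie on the same diagonal, and it carries the same sign. The next simplest zero-sum
  supports are alternating hexagons, with two cells in each of three rows and three columns.
\<close>

lemma isolating_patterns_diagonal:
  "isolating_patterns
     [[ 1, 0,-1, 0, 0],
      [ 0, 0, 0, 0, 0],
      [-1, 0, 0, 1, 0],
      [ 0, 0, 1,-1, 0],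
      [ 0, 0, 0, 0, 0]]
     [[ 1, 0, 0, 0,-1],
      [ 0,-1, 0, 0, 1],
      [ 0, 0, 0, 0, 0],
      [-1, 1, 0, 0, 0],
      [ 0, 0, 0, 0, 0]] 0 0"
  by code_simp

text \<open>
  The mirror images of the patterns for the diagonal.
\<close>

lemma isolating_patterns_anti_diagonal:
  "isolating_patterns
     [[ 0, 0,-1, 0, 1],
      [ 0, 0, 0, 0, 0],
      [ 0, 1, 0, 0,-1],
      [ 0,-1, 1, 0, 0],
      [ 0, 0, 0, 0, 0]]
     [[-1, 0, 0, 0, 1],
      [ 1, 0, 0,-1, 0],
      [ 0, 0, 0, 0, 0],
      [ 0, 0, 0, 1,-1],
      [ 0, 0, 0, 0, 0]] 0 4"
  by code_simp

text \<open>
  A hexagon and the rectangle \<open>{z, y'} \<times> {x, x'}\<close>.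
\<close>

lemma isolating_patterns_middle_row:
  "isolating_patterns
     [[ 0, 0, 0, 0, 0],
      [ 0, 0, 0, 0, 0],
      [ 1,-1, 0, 0, 0],
      [ 0, 1,-1, 0, 0],
      [-1, 0, 1, 0, 0]]
     [[ 0, 0, 0, 0, 0],
      [ 0, 0, 0, 0, 0],
      [ 1, 0, 0, 0,-1],
      [-1, 0, 0, 0, 1],
      [ 0, 0, 0, 0, 0]] 2 0"
  by code_simp

text \<open>
  The transposes of the patterns for the middle row.
\<close>

lemma isolating_patterns_middle_col:
  "isolating_patterns
     [[ 0, 0, 1, 0,-1],
      [ 0, 0,-1, 1, 0],
      [ 0, 0, 0,-1, 1],
      [ 0, 0, 0, 0, 0],
      [ 0, 0, 0, 0, 0]]
     [[ 0, 0, 1,-1, 0],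
      [ 0, 0, 0, 0, 0],
      [ 0, 0, 0, 0, 0],
      [ 0, 0, 0, 0, 0],
      [ 0, 0,-1, 1, 0]] 0 2"
  by code_simp

text \<open>
  The central cell lies on both diagonals, and each of the two sums needs a compensating entry.
  These patterns have a nonzero central entry, so they require \<open>z = z'\<close>, which holds when the cell is
  the centre of a square of odd size.
\<close>

lemma isolating_patterns_centre:
  "isolating_patterns
     [[ 0, 0, 0, 1,-1],
      [ 0, 0, 0, 0, 0],
      [ 0, 0, 1,-1, 0],
      [ 0, 0, 0,-1, 1],
      [ 0, 0,-1, 1, 0]]
     [[ 0, 0, 0, 0, 0],
      [ 0,-1, 0, 0, 1],
      [ 0, 0, 1, 0,-1],
      [ 1, 0,-1, 0, 0],
      [-1, 1, 0, 0, 0]] 2 2"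
  by code_simp


section \<open>Every cell can be isolated\<close>

lemma fresh_index:
  assumes "length xs < n"
  obtains y where "y < n" "y \<notin> set xs"
proof -
  have "\<not> {..<n} \<subseteq> set xs"
  proof
    assume "{..<n} \<subseteq> set xs"
    then have "n \<le> card (set xs)" using card_mono[of "set xs" "{..<n}"] by simp
    with card_length[of xs] assms show False by linarith
  qed
  with that show thesis by auto
qed

lemma fresh_pair:
  fixes n x :: nat
  assumes "n \<ge> 5"
  obtains y where "y < n" "y \<notin> {x, n - 1 - x}" "y \<noteq> n - 1 - y"
proof -
  \<comment> \<open>Only \<open>(n - 1) div 2\<close> can be fixed by reversal.\<close>
  obtain y where "y < n" "y \<notin> set [x, n - 1 - x, (n - 1) div 2]"
    using fresh_index[of "[x, n - 1 - x, (n - 1) div 2]" n] assms by auto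
  moreover from this have "y \<noteq> n - 1 - y" by auto
  ultimately show thesis by (intro that) auto
qed

lemma fresh_third:
  fixes n x y :: nat
  assumes "n \<ge> 5"
  obtains z where "z < n" "z \<notin> {x, n - 1 - x, y, n - 1 - y}"
  using fresh_index[of "[x, n - 1 - x, y, n - 1 - y]" n] assms by auto

text \<open>
  A row or column of the cell that is fixed by reversal has to serve as the index \<open>z\<close> of the frame;
  in all other cases \<open>x\<close> is the row, and \<open>z\<close> is an arbitrary remaining index.
\<close>

lemma every_cell_isolable:
  assumes n: "n \<ge> 5" and r: "r < n" and c: "c < n"
  shows "isolable n (r, c)"
proof -
  consider (centre) "r = n - 1 - r" "c = n - 1 - c"
    | (middle_row) "r = n - 1 - r" "c \<noteq> n - 1 - c"
    | (middle_col) "r \<noteq> n - 1 - r" "c = n - 1 - c"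
    | (diagonal) "r \<noteq> n - 1 - r" "c = r"
    | (anti) "r \<noteq> n - 1 - r" "c = n - 1 - r"
    | (off) "r \<noteq> n - 1 - r" "c \<noteq> n - 1 - c" "c \<noteq> r" "c \<noteq> n - 1 - r"
    by blast
  then show ?thesis
  proof cases
    case centre
    with r c have "c = r" by linarith
    obtain x where x: "x < n" "x \<notin> {r, n - 1 - r}" "x \<noteq> n - 1 - x"
      using fresh_pair[OF n] .
    obtain y where y: "y < n" "y \<notin> {x, n - 1 - x}" "y \<noteq> n - 1 - y"
      using fresh_pair[OF n] .
    have "r \<notin> {x, n - 1 - x}" "r \<notin> {y, n - 1 - y}"
      using centre(1) x y r by auto
    then have "r \<notin> {x, n - 1 - x, y, n - 1 - y}" by auto
    from isolable_frame[OF x(1) y(1) r x(3) y(3,2) this isolating_patterns_centre] centre(1)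
    show ?thesis by (simp add: \<open>c = r\<close>)
  next
    case middle_row
    obtain y where y: "y < n" "y \<notin> {c, n - 1 - c}" "y \<noteq> n - 1 - y"
      using fresh_pair[OF n] .
    have "r \<notin> {c, n - 1 - c, y, n - 1 - y}"
      using middle_row y r by auto
    from isolable_frame[OF c y(1) r middle_row(2) y(3,2) this isolating_patterns_middle_row] middle_row
    show ?thesis by simp
  next
    case middle_col
    obtain y where y: "y < n" "y \<notin> {r, n - 1 - r}" "y \<noteq> n - 1 - y"
      using fresh_pair[OF n] .
    have "c \<notin> {r, n - 1 - r, y, n - 1 - y}"
      using middle_col y c by auto
    from isolable_frame[OF r y(1) c middle_col(1) y(3,2) this isolating_patterns_middle_col] middle_col
    show ?thesis by simp
  next
    case diagonal
    obtain y where y: "y < n" "y \<notin> {r, n - 1 - r}" "y \<noteq> n - 1 - y"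
      using fresh_pair[OF n] .
    obtain z where z: "z < n" "z \<notin> {r, n - 1 - r, y, n - 1 - y}"
      using fresh_third[OF n] .
    from isolable_frame[OF r y(1) z(1) diagonal(1) y(3,2) z(2) isolating_patterns_diagonal] diagonal
    show ?thesis by (simp add: pattern_def)
  next
    case anti
    obtain y where y: "y < n" "y \<notin> {r, n - 1 - r}" "y \<noteq> n - 1 - y"
      using fresh_pair[OF n] .
    obtain z where z: "z < n" "z \<notin> {r, n - 1 - r, y, n - 1 - y}"
      using fresh_third[OF n] .
    from isolable_frame[OF r y(1) z(1) anti(1) y(3,2) z(2) isolating_patterns_anti_diagonal] anti
    show ?thesis by (simp add: pattern_def)
  next
    case off
    obtain z where z: "z < n" "z \<notin> {r, n - 1 - r, c, n - 1 - c}"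
      using fresh_third[OF n] .
    have "c \<notin> {r, n - 1 - r}" using off by simp
    from isolable_frame[OF r c z(1) off(1,2) this z(2) isolating_patterns_off_diagonal]
    show ?thesis by (simp add: pattern_def)
  qed
qed

theorem proposition7:
  fixes n :: nat
  assumes "n \<ge> 5"
  shows "complexity (elephant_form n) (n\<^sup>2) = 1"
proof (rule complexity_eq_oneI)
  fix i assume i: "i \<in> {1..n\<^sup>2}"
  have "cell_of n i \<in> cells n"
    using i bij_betw_cell_of[of n] assms by (auto simp: bij_betw_def)
  then have "isolable n (cell_of n i)"
    using every_cell_isolable[OF assms] by (auto simp: cells_def)
  with assms i show "index_complexity_le (elephant_form n) (n\<^sup>2) i 1"
    by (rule isolable_imp_index_complexity_le)
next
  show "1 \<in> {1..n\<^sup>2}" using assms by simp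
  show "\<not> index_complexity_le (elephant_form n) (n\<^sup>2) 1 0"
    by (rule first_entry_dependent[OF assms])
qed

end
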